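(* Let $G=(V,E)$ be a random UTSW graph built on the $n\times n$ torus, $n\ge 3$, and for $u\in V$ let $E_u$ be the event that there exists at least one four-cycle rooted at $u$ in $G$ that contains at least one long-range edge (equivalently, a four-cycle rooted at $u$ that is in $G$ but not in the torus $T$). Then $\Pr(E_u)=O\left(\log^{-1} n\right)$ as $n\to\infty$ (uniformly in $u\in V$).
   Context: Let $n\ge 3$ be an integer and $[\![n]\!]=\{0,1,\dots,n-1\}$. The two-dimensional undirected torus $T=(V,E_T)$ of size $n$ has vertex set $V=[\![n]\!]^2$ (so $|V|=n^2$), and each vertex $(i,j)$ is adjacent to $(i,(j+1)\bmod n)$ and $((i+1)\bmod n,j)$. For $u=(x_u,y_u),v=(x_v,y_v)\in V$ let $d_{uv}=\min(|x_u-x_v|,n-|x_u-x_v|)+\min(|y_u-y_v|,n-|y_u-y_v|)$ (the distance in $T$). The normalizing factor is $Z=\left(\sum_{w\in V\setminus\{u\}} d_{uw}^{-2}\right)^{-1}$, which does not depend on $u$. The UTSW (undirected toroidal small world) random graph $G=(V,E)$ is obtained as follows: independently for each $u\in V$, $u$ chooses one vertex $v\in V\setminus\{u\}$, choosing $v$ with probability $Z\,d_{uv}^{-2}$; let $C_{uv}$ be the event that $u$ chooses $v$. Then $E=E_T\cup\{\{u,v\}: C_{uv}\text{ occurs}\}$ (without parallel edges). Edges in $E_T$ are called local edges and edges in $E\setminus E_T$ long-range edges. A four-cycle rooted at $u$ is a sequence $(u,v_1,v_2,v_3)$ of four pairwise distinct vertices with $\{u,v_1\},\{v_1,v_2\},\{v_2,v_3\},\{v_3,u\}\in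 E$. *)

theory Defs
  imports "HOL-Probability.Probability" "HOL-Probability.Product_PMF"
begin

type_synonym vertex = "nat \<times> nat"

definition torus_vertices :: "nat \<Rightarrow> vertex set" where
  "torus_vertices n = {0..<n} \<times> {0..<n}"

definition torus_edges :: "nat \<Rightarrow> vertex set set" where
  "torus_edges n =
     (\<Union>(i, j) \<in> torus_vertices n. {{(i, j), (i, (j + 1) mod n)}, {(i, j), ((i + 1) mod n, j)}})"

definition cyclic_dist :: "nat \<Rightarrow> nat \<Rightarrow> nat \<Rightarrow> int" where
  "cyclic_dist n a b = min \<bar>int a - int b\<bar> (int n - \<bar>int a - int b\<bar>)"

definition torus_dist :: "nat \<Rightarrow> vertex \<Rightarrow> vertex \<Rightarrow> int" where
  "torus_dist n u v = cyclic_dist n (fst u) (fst v) + cyclic_dist n (snd u) (snd v)"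

text \<open>By the symmetry of the torus this does not depend on the vertex \<open>u\<close>.\<close>

definition utsw_Z :: "nat \<Rightarrow> vertex \<Rightarrow> real" where
  "utsw_Z n u = inverse (\<Sum>w \<in> torus_vertices n - {u}. 1 / (real_of_int (torus_dist n u w))\<^sup>2)"

definition choice_prob :: "nat \<Rightarrow> vertex \<Rightarrow> vertex \<Rightarrow> real" where
  "choice_prob n u v =
     (if v \<in> torus_vertices n - {u}
      then utsw_Z n u * (1 / (real_of_int (torus_dist n u v))\<^sup>2) else 0)"

definition choice_pmf :: "nat \<Rightarrow> vertex \<Rightarrow> vertex pmf" where
  "choice_pmf n u = embed_pmf (choice_prob n u)"

lemma finite_torus_vertices: "finite (torus_vertices n)"
  by (simp add: torus_vertices_def)

lemma cyclic_dist_nonneg: "a < n \<Longrightarrow> b < n \<Longrightarrow> 0 \<le> cyclic_dist n a b"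
  by (auto simp: cyclic_dist_def)

lemma cyclic_dist_pos: "a < n \<Longrightarrow> b < n \<Longrightarrow> a \<noteq> b \<Longrightarrow> 0 < cyclic_dist n a b"
  by (auto simp: cyclic_dist_def)

lemma torus_dist_pos:
  assumes "u \<in> torus_vertices n" "v \<in> torus_vertices n" "u \<noteq> v"
  shows "0 < torus_dist n u v"
proof -
  have b: "fst u < n" "snd u < n" "fst v < n" "snd v < n"
    using assms by (auto simp: torus_vertices_def)
  have "fst u \<noteq> fst v \<or> snd u \<noteq> snd v"
    using assms(3) by (simp add: prod_eq_iff)
  then show ?thesis
    unfolding torus_dist_def
    using b cyclic_dist_nonneg cyclic_dist_pos by (meson add_nonneg_pos add_pos_nonneg)
qed

text \<open>The weights \<open>choice_prob n u\<close> form a probability mass function, so \<open>embed_pmf\<close> is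
  applied within its domain.\<close>

lemma pmf_choice_pmf:
  assumes "n \<ge> 2" "u \<in> torus_vertices n"
  shows "pmf (choice_pmf n u) v = choice_prob n u v"
proof -
  let ?V = "torus_vertices n - {u}"
  let ?w = "\<lambda>v. 1 / (real_of_int (torus_dist n u v))\<^sup>2"
  have fin: "finite ?V" by (simp add: finite_torus_vertices)
  obtain w where w: "w \<in> ?V"
  proof -
    have "(0, 0) \<in> torus_vertices n" "(0, 1) \<in> torus_vertices n"
      using assms by (auto simp: torus_vertices_def)
    then show ?thesis using that by (cases "u = (0, 0)") auto
  qed
  have pos: "?w v > 0" if "v \<in> ?V" for v
    using torus_dist_pos[OF assms(2), of v] that by auto
  have S: "(\<Sum>v\<in>?V. ?w v) > 0"
    using fin w pos by (intro sum_pos) auto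
  have nonneg: "choice_prob n u v \<ge> 0" for v
    using S by (auto simp: choice_prob_def utsw_Z_def)
  have one: "(\<Sum>v\<in>?V. choice_prob n u v) = 1"
  proof -
    have "(\<Sum>v\<in>?V. choice_prob n u v) = (\<Sum>v\<in>?V. utsw_Z n u * ?w v)"
      by (rule sum.cong) (simp_all add: choice_prob_def)
    also have "\<dots> = utsw_Z n u * (\<Sum>v\<in>?V. ?w v)"
      by (simp only: sum_distrib_left)
    also have "\<dots> = 1"
      using S unfolding utsw_Z_def by (intro left_inverse) simp
    finally show ?thesis .
  qed
  have "(\<integral>\<^sup>+ v. ennreal (choice_prob n u v) \<partial>count_space UNIV)
      = (\<Sum>v\<in>?V. ennreal (choice_prob n u v))"
    by (rule nn_integral_count_space'[OF fin]) (auto simp: choice_prob_def)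
  also have "\<dots> = 1"
    using nonneg one by (simp add: sum_ennreal)
  finally show ?thesis
    unfolding choice_pmf_def using nonneg by (intro pmf_embed_pmf) auto
qed

definition utsw_edges :: "nat \<Rightarrow> (vertex \<Rightarrow> vertex) \<Rightarrow> vertex set set" where
  "utsw_edges n c = torus_edges n \<union> {{u, c u} | u. u \<in> torus_vertices n}"

text \<open>The distribution of the edge set of the random graph. \<open>Pi_pmf\<close> makes the choices \<open>c u\<close>
  of the vertices \<open>u\<close> independent; \<open>undefined\<close> is the irrelevant value of \<open>c\<close> outside the torus.\<close>

definition utsw_pmf :: "nat \<Rightarrow> vertex set set pmf" where
  "utsw_pmf n =
     map_pmf (utsw_edges n) (Pi_pmf (torus_vertices n) undefined (choice_pmf n))"

definition rooted_four_cycle ::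
  "nat \<Rightarrow> vertex set set \<Rightarrow> vertex \<Rightarrow> vertex \<Rightarrow> vertex \<Rightarrow> vertex \<Rightarrow> bool" where
  "rooted_four_cycle n E u v1 v2 v3 \<longleftrightarrow>
     {u, v1, v2, v3} \<subseteq> torus_vertices n \<and> distinct [u, v1, v2, v3] \<and>
     {u, v1} \<in> E \<and> {v1, v2} \<in> E \<and> {v2, v3} \<in> E \<and> {v3, u} \<in> E"

definition has_long_range_four_cycle :: "nat \<Rightarrow> vertex set set \<Rightarrow> vertex \<Rightarrow> bool" where
  "has_long_range_four_cycle n E u \<longleftrightarrow>
     (\<exists>v1 v2 v3. rooted_four_cycle n E u v1 v2 v3 \<and>
        (\<exists>e \<in> {{u, v1}, {v1, v2}, {v2, v3}, {v3, u}}. e \<in> E - torus_edges n))"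

end

theory Submission
  imports Defs
begin

text \<open>Give an unordered pair the weight \<open>1\<close> if it is a local edge, plus the two probabilities that
  one endpoint chooses the other. Distinct edges that are all long-range need distinct choosers, so
  the probability that a set of edges is present is at most the product of their weights. In a
  four-cycle, bound the weight of one long-range edge by \<open>2 * Z \<le> 2 / ln n\<close>; what remains is a path
  of three edges through \<open>u\<close>, and summing over its vertices costs a factor at most \<open>6\<close> per edge,
  because the weights at a vertex add up to at most \<open>4 + 1 + 1\<close>.\<close>

section \<open>Prescribed choices under the product distribution\<close>

lemma prob_Pi_pmf_choices_le:
  assumes "finite A" "finite D" "fst ` D \<subseteq> A"
  shows "measure_pmf.prob (Pi_pmf A dflt p) {c. \<forall>(x, y)\<in>D. c x = y}
           \<le> (\<Prod>(x, y)\<in>D. pmf (p x) y)"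
proof (cases "inj_on fst D")
  case True
  \<comment> \<open>The event is a box: \<open>B x\<close> is the set of targets allowed to
    \<open>x\<close>, a singleton for a chooser prescribed by \<open>D\<close> and everything
    otherwise. Independence then gives equality with the product.\<close>
  define B where "B x = {y. \<forall>y'. (x, y') \<in> D \<longrightarrow> y = y'}" for x
  have single: "B (fst z) = {snd z}" if "z \<in> D" for z
    using True that unfolding B_def inj_on_def by (cases z) force
  have all: "B x = UNIV" if "x \<notin> fst ` D" for x
    using that unfolding B_def by force
  have "{c. \<forall>(x, y)\<in>D. c x = y} = Pi A B"
    using assms(3) by (fastforce simp: B_def Pi_def)
  then have "measure_pmf.prob (Pi_pmf A dflt p) {c. \<forall>(x, y)\<in>D. c x = y}
      = (\<Prod>x\<in>A. measure_pmf.prob (p x) (B x))"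
    using assms(1) by (simp add: measure_Pi_pmf_Pi)
  also have "\<dots> = (\<Prod>x\<in>fst ` D. measure_pmf.prob (p x) (B x))"
    using assms all by (intro prod.mono_neutral_right) auto
  also have "\<dots> = (\<Prod>z\<in>D. measure_pmf.prob (p (fst z)) (B (fst z)))"
    by (simp add: prod.reindex[OF True])
  also have "\<dots> = (\<Prod>(x, y)\<in>D. pmf (p x) y)"
    by (intro prod.cong) (auto simp: single measure_pmf_single split: prod.splits)
  finally show ?thesis by simp
next
  case False
  \<comment> \<open>Some vertex would have to choose two different targets. This conflict is why
    only an inequality is stated.\<close>
  then have "{c. \<forall>(x, y)\<in>D. c x = y} = {}"
    by (clarsimp simp: inj_on_def) (metis (mono_tags, lifting) case_prodD)
  then have "measure_pmf.prob (Pi_pmf A dflt p) {c. \<forall>(x, y)\<in>D. c x = y} = 0"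
    by (simp only: measure_empty)
  also have "\<dots> \<le> (\<Prod>(x, y)\<in>D. pmf (p x) y)"
    by (auto intro!: prod_nonneg)
  finally show ?thesis .
qed

section \<open>The torus metric and the normalizing factor\<close>

lemma cyclic_dist_commute: "cyclic_dist n a b = cyclic_dist n b a"
  by (simp add: cyclic_dist_def abs_minus_commute)

lemma torus_dist_commute: "torus_dist n u v = torus_dist n v u"
  by (simp add: torus_dist_def cyclic_dist_commute)

text \<open>Translation by \<open>a\<close> modulo \<open>n\<close> permutes the residues and
  preserves cyclic distance. As \<open>f\<close> is arbitrary, the two coordinates of the torus can
  be recentred one after the other.\<close>

lemma sum_cyclic_dist:
  assumes "a < n"
  shows "(\<Sum>b<n. f (cyclic_dist n a b)) = (\<Sum>b<n. f (cyclic_dist n 0 b))"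
proof (rule sum.reindex_bij_witness[where
      i = "\<lambda>b. if a + b < n then a + b else a + b - n" and
      j = "\<lambda>b. if a \<le> b then b - a else b + n - a"])
  fix b assume "b \<in> {..<n}"
  then show "f (cyclic_dist n 0 (if a \<le> b then b - a else b + n - a)) = f (cyclic_dist n a b)"
    using assms by (intro arg_cong[of _ _ f]) (auto simp: cyclic_dist_def min_def)
qed (use assms in \<open>auto split: if_splits\<close>)

text \<open>The summand at \<open>w = u\<close> may be added because \<open>1 / 0 = 0\<close>.\<close>

lemma utsw_Z_eq:
  assumes "u \<in> torus_vertices n"
  shows "utsw_Z n u
    = inverse (\<Sum>x<n. \<Sum>y<n. 1 / (real_of_int (cyclic_dist n 0 x + cyclic_dist n 0 y))\<^sup>2)"
proof -
  let ?f = "\<lambda>i j. 1 / (real_of_int (i + j))\<^sup>2"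
  obtain a b where u: "u = (a, b)" "a < n" "b < n"
    using assms by (auto simp: torus_vertices_def)
  have "(\<Sum>w\<in>torus_vertices n - {u}. 1 / (real_of_int (torus_dist n u w))\<^sup>2)
      = (\<Sum>w\<in>torus_vertices n. 1 / (real_of_int (torus_dist n u w))\<^sup>2)"
    by (rule sum.mono_neutral_left)
       (auto simp: finite_torus_vertices torus_dist_def cyclic_dist_def u min_def)
  also have "\<dots> = (\<Sum>x<n. \<Sum>y<n. ?f (cyclic_dist n a x) (cyclic_dist n b y))"
    by (simp add: torus_vertices_def sum.cartesian_product torus_dist_def u lessThan_atLeast0
        case_prod_unfold)
  also have "\<dots> = (\<Sum>x<n. \<Sum>y<n. ?f (cyclic_dist n a x) (cyclic_dist n 0 y))"
    using u by (intro sum.cong refl sum_cyclic_dist[of _ _ "\<lambda>j. ?f _ j"]) auto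
  also have "\<dots> = (\<Sum>x<n. \<Sum>y<n. ?f (cyclic_dist n 0 x) (cyclic_dist n 0 y))"
    using u by (intro sum_cyclic_dist[of _ _ "\<lambda>i. \<Sum>y<n. ?f i (cyclic_dist n 0 y)"]) auto
  finally show ?thesis
    by (simp add: utsw_Z_def)
qed

text \<open>For \<open>0 < k < n\<close>, the \<open>k + 1\<close> points \<open>(i, k - i)\<close> have distance at most \<open>k\<close> from the origin,
  so they contribute at least \<open>1 / k\<close>.\<close>

lemma utsw_Z_le:
  assumes "n \<ge> 2" "u \<in> torus_vertices n"
  shows "utsw_Z n u \<le> 1 / ln (real n)"
proof -
  let ?g = "\<lambda>x y. 1 / (real_of_int (cyclic_dist n 0 x + cyclic_dist n 0 y))\<^sup>2"
  let ?S = "SIGMA k:{1..n - 1}. {0..k}"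
  have "ln (real n) = ln (real (n - 1) + 1)"
    using assms by (simp add: of_nat_diff)
  also have "\<dots> \<le> harm (n - 1)"
    by (rule ln_le_harm)
  also have "\<dots> = (\<Sum>k\<in>{1..n - 1}. 1 / real k)"
    by (simp add: harm_def inverse_eq_divide)
  also have "\<dots> \<le> (\<Sum>k\<in>{1..n - 1}. \<Sum>i\<in>{0..k}. ?g i (k - i))"
  proof (rule sum_mono)
    fix k assume k: "k \<in> {1..n - 1}"
    have "1 / real k \<le> real (card {0..k}) * (1 / (real k)\<^sup>2)"
      using k by (simp add: field_simps power2_eq_square)
    also have "\<dots> \<le> (\<Sum>i\<in>{0..k}. ?g i (k - i))"
    proof (rule sum_bounded_below)
      fix i assume i: "i \<in> {0..k}"
      let ?d = "cyclic_dist n 0 i + cyclic_dist n 0 (k - i)"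
      \<comment> \<open>The cyclic distance from \<open>0\<close> to \<open>j\<close> is at most
        \<open>j\<close>. Positivity matters because of \<open>1 / 0 = 0\<close>; it holds since
        \<open>i\<close> and \<open>k - i\<close> are below \<open>n\<close> and not both
        zero.\<close>
      have "?d \<le> int k" "0 < ?d"
        using i k by (auto simp: cyclic_dist_def min_def)
      then have "(real_of_int ?d)\<^sup>2 \<le> (real k)\<^sup>2" "0 < (real_of_int ?d)\<^sup>2"
        by (auto intro!: power_mono)
      then show "1 / (real k)\<^sup>2 \<le> ?g i (k - i)"
        by (simp add: frac_le)
    qed
    finally show "1 / real k \<le> (\<Sum>i\<in>{0..k}. ?g i (k - i))" .
  qed
  also have "\<dots> = (\<Sum>(k, i)\<in>?S. ?g i (k - i))"
    by (rule sum.Sigma) auto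
  \<comment> \<open>Antidiagonals for different \<open>k\<close> are disjoint, so no grid point is
    counted twice.\<close>
  also have "\<dots> = (\<Sum>(x, y)\<in>(\<lambda>(k, i). (i, k - i)) ` ?S. ?g x y)"
    by (subst sum.reindex) (auto simp: inj_on_def case_prod_unfold)
  also have "\<dots> \<le> (\<Sum>(x, y)\<in>{..<n} \<times> {..<n}. ?g x y)"
    using assms by (intro sum_mono2) auto
  also have "\<dots> = (\<Sum>x<n. \<Sum>y<n. ?g x y)"
    by (simp add: sum.cartesian_product)
  finally have "ln (real n) \<le> (\<Sum>x<n. \<Sum>y<n. ?g x y)" .
  moreover have "0 < ln (real n)"
    using assms by simp
  ultimately show ?thesis
    unfolding utsw_Z_eq[OF assms(2)] inverse_eq_divide by (intro frac_le) auto
qed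

section \<open>Choice probabilities and degrees in the torus\<close>

lemma choice_prob_commute:
  assumes "u \<in> torus_vertices n" "v \<in> torus_vertices n"
  shows "choice_prob n u v = choice_prob n v u"
  using assms by (auto simp: choice_prob_def utsw_Z_eq torus_dist_commute[of n u v])

lemma choice_prob_nonneg: "choice_prob n u v \<ge> 0"
  by (simp add: choice_prob_def utsw_Z_def sum_nonneg)

lemma choice_prob_le:
  assumes "n \<ge> 2" "u \<in> torus_vertices n"
  shows "choice_prob n u v \<le> 1 / ln (real n)"
proof (cases "v \<in> torus_vertices n - {u}")
  case True
  have "1 \<le> real_of_int (torus_dist n u v)"
    using torus_dist_pos[OF assms(2), of v] True by auto
  then have "1 / (real_of_int (torus_dist n u v))\<^sup>2 \<le> 1"
    by simp
  moreover have "0 \<le> utsw_Z n u"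
    by (simp add: utsw_Z_def sum_nonneg)
  ultimately have "choice_prob n u v \<le> utsw_Z n u"
    unfolding choice_prob_def by (simp only: True if_True mult_left_le)
  with utsw_Z_le[OF assms] show ?thesis by simp
qed (use assms in \<open>auto simp: choice_prob_def\<close>)

lemma sum_choice_prob:
  assumes "n \<ge> 2" "u \<in> torus_vertices n"
  shows "(\<Sum>v\<in>torus_vertices n. choice_prob n u v) \<le> 1"
proof -
  have "(\<Sum>v\<in>torus_vertices n. choice_prob n u v)
      = measure_pmf.prob (choice_pmf n u) (torus_vertices n)"
    by (simp add: measure_measure_pmf_finite finite_torus_vertices pmf_choice_pmf[OF assms])
  then show ?thesis by simp
qed

lemma card_torus_neighbours_le:
  assumes "u \<in> torus_vertices n"
  shows "card {v \<in> torus_vertices n. {u, v} \<in> torus_edges n} \<le> 4"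
proof -
  obtain i j where u: "u = (i, j)" "i < n" "j < n"
    using assms by (auto simp: torus_vertices_def)
  \<comment> \<open>The cyclic predecessor inverts the cyclic successor; this handles local edges
    generated from the other endpoint. Adding \<open>n\<close> first avoids truncated
    subtraction.\<close>
  have pred: "k = (m + n - 1) mod n" if "k < n" "m = Suc k mod n" for k m
    using that by (cases "Suc k = n") auto
  let ?N = "[(i, (j + 1) mod n), ((i + 1) mod n, j), (i, (j + n - 1) mod n), ((i + n - 1) mod n, j)]"
  have "{v \<in> torus_vertices n. {u, v} \<in> torus_edges n} \<subseteq> set ?N"
    using pred by (auto simp: torus_edges_def torus_vertices_def u doubleton_eq_iff)
  then have "card {v \<in> torus_vertices n. {u, v} \<in> torus_edges n} \<le> card (set ?N)"
    by (intro card_mono) auto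
  also have "\<dots> \<le> length ?N"
    by (rule card_length)
  finally show ?thesis by simp
qed

section \<open>Edge weights and their sum at a vertex\<close>

definition edge_weight :: "nat \<Rightarrow> vertex \<Rightarrow> vertex \<Rightarrow> real" where
  "edge_weight n x y =
     of_bool ({x, y} \<in> torus_edges n) + choice_prob n x y + choice_prob n y x"

lemma edge_weight_commute: "edge_weight n x y = edge_weight n y x"
  by (simp add: edge_weight_def insert_commute)

lemma edge_weight_nonneg: "edge_weight n x y \<ge> 0"
  by (simp add: edge_weight_def choice_prob_nonneg)

lemma sum_edge_weight:
  assumes "n \<ge> 2" "u \<in> torus_vertices n"
  shows "(\<Sum>v\<in>torus_vertices n. edge_weight n u v) \<le> 6"
proof -
  have "(\<Sum>v\<in>torus_vertices n. of_bool ({u, v} \<in> torus_edges n) :: real) \<le> 4"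
    using card_torus_neighbours_le[OF assms(2)]
    by (simp add: sum_of_bool_eq finite_torus_vertices Int_def)
  \<comment> \<open>By symmetry, the expected number of vertices choosing \<open>u\<close> equals
    the total mass of the choice made by \<open>u\<close>.\<close>
  moreover have "(\<Sum>v\<in>torus_vertices n. choice_prob n v u) = (\<Sum>v\<in>torus_vertices n. choice_prob n u v)"
    using assms by (intro sum.cong refl choice_prob_commute)
  ultimately show ?thesis
    using sum_choice_prob[OF assms] by (simp add: edge_weight_def sum.distrib)
qed

section \<open>Probability that given edges are present\<close>

definition present :: "nat \<Rightarrow> (vertex \<Rightarrow> vertex) \<Rightarrow> vertex \<Rightarrow> vertex \<Rightarrow> bool" where
  "present n c x y \<longleftrightarrow> {x, y} \<in> torus_edges n \<or> c x = y \<or> c y = x"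

lemma present_commute: "present n c x y = present n c y x"
  by (auto simp: present_def insert_commute)

text \<open>Implications suffice for upper bounds: \<open>present\<close> does not ask that the
  chooser lie in the torus.\<close>

lemma utsw_edgesD:
  "{x, y} \<in> utsw_edges n c \<Longrightarrow> present n c x y"
  "{x, y} \<in> utsw_edges n c - torus_edges n \<Longrightarrow> c x = y \<or> c y = x"
  by (auto simp: utsw_edges_def present_def doubleton_eq_iff)

abbreviation choices_pmf :: "nat \<Rightarrow> (vertex \<Rightarrow> vertex) pmf" where
  "choices_pmf n \<equiv> Pi_pmf (torus_vertices n) undefined (choice_pmf n)"

text \<open>\<open>D\<close> holds the choices already fixed, \<open>F\<close> the edges still open,
  each in one orientation. The induction removes an edge from \<open>F\<close>; unless it is local,
  it enters \<open>D\<close> in either orientation. Disjointness makes each such insertion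
  contribute a new factor.\<close>

lemma prob_present_le:
  assumes n: "n \<ge> 2"
    and "finite F" "F \<subseteq> torus_vertices n \<times> torus_vertices n" "F \<inter> F\<inverse> = {}"
    and "finite D" "D \<subseteq> torus_vertices n \<times> torus_vertices n" "D \<inter> F = {}" "D \<inter> F\<inverse> = {}"
  shows "measure_pmf.prob (choices_pmf n)
      {c. (\<forall>(x, y)\<in>D. c x = y) \<and> (\<forall>(x, y)\<in>F. present n c x y)}
    \<le> (\<Prod>(x, y)\<in>D. choice_prob n x y) * (\<Prod>(x, y)\<in>F. edge_weight n x y)"
  using assms(2-)
proof (induction F arbitrary: D rule: finite_induct)
  case empty
  have "(\<Prod>(x, y)\<in>D. pmf (choice_pmf n x) y) = (\<Prod>(x, y)\<in>D. choice_prob n x y)"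
    using empty n by (intro prod.cong) (auto simp: pmf_choice_pmf)
  moreover have "fst ` D \<subseteq> torus_vertices n"
    using empty by auto
  ultimately show ?case
    using prob_Pi_pmf_choices_le[of "torus_vertices n" D undefined "choice_pmf n"] empty
    by (simp add: finite_torus_vertices)
next
  case (insert e F)
  obtain a b where e: "e = (a, b)" by (cases e)
  let ?P = "measure_pmf.prob (choices_pmf n)"
  let ?X = "\<lambda>D F. {c. (\<forall>(x, y)\<in>D. c x = y) \<and> (\<forall>(x, y)\<in>F. present n c x y)}"
  let ?p = "\<lambda>D. \<Prod>(x, y)\<in>D. choice_prob n x y"
  let ?q = "\<Prod>(x, y)\<in>F. edge_weight n x y"
  have nonneg: "0 \<le> ?q" "0 \<le> ?p D"
    by (auto intro!: prod_nonneg edge_weight_nonneg choice_prob_nonneg)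
  have IH: "?P (?X D F) \<le> ?p D * ?q"
    using insert.prems by (intro insert.IH) auto
  have ab: "(a, b) \<notin> D" "(b, a) \<notin> D" "(a, b) \<notin> F" "(b, a) \<notin> F"
    using insert.prems insert.hyps e by auto
  have IH1: "?P (?X (insert (x, y) D) F) \<le> choice_prob n x y * (?p D * ?q)"
    if "(x, y) \<in> {(a, b), (b, a)}" for x y
  proof -
    have xy: "(x, y) \<notin> D" "(x, y) \<notin> F" "(y, x) \<notin> F" "(x, y) \<in> torus_vertices n \<times> torus_vertices n"
      using that ab insert.prems e by auto
    have "?P (?X (insert (x, y) D) F) \<le> ?p (insert (x, y) D) * ?q"
      using insert.prems xy by (intro insert.IH) auto
    then show ?thesis
      using xy insert.prems by (simp add: mult.assoc)
  qed
  have "?P (?X D (insert e F)) \<le> edge_weight n a b * (?p D * ?q)"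
  proof (cases "{a, b} \<in> torus_edges n")
    case True
    then have "1 \<le> edge_weight n a b"
      by (simp add: edge_weight_def choice_prob_nonneg)
    \<comment> \<open>A local edge is always present, so its condition is dropped; its weight is at
      least \<open>1\<close>.\<close>
    have "?P (?X D (insert e F)) \<le> ?P (?X D F)"
      by (rule measure_pmf.finite_measure_mono) auto
    also note IH
    also have "?p D * ?q \<le> edge_weight n a b * (?p D * ?q)"
      using mult_right_mono[OF \<open>1 \<le> edge_weight n a b\<close>, of "?p D * ?q"] nonneg by simp
    finally show ?thesis .
  next
    case False
    \<comment> \<open>Otherwise one endpoint chose the other; the two cases add up to the edge
      weight.\<close>
    have "?P (?X D (insert e F)) \<le> ?P (?X (insert (a, b) D) F \<union> ?X (insert (b, a) D) F)"
      using False by (intro measure_pmf.finite_measure_mono) (auto simp: e present_def)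
    also have "\<dots> \<le> ?P (?X (insert (a, b) D) F) + ?P (?X (insert (b, a) D) F)"
      by (rule measure_Un_le) auto
    also have "\<dots> \<le> choice_prob n a b * (?p D * ?q) + choice_prob n b a * (?p D * ?q)"
      by (intro add_mono IH1) auto
    finally show ?thesis
      using False by (simp add: edge_weight_def distrib_right)
  qed
  then show ?case
    using insert.hyps e by (simp add: mult.left_commute)
qed

section \<open>Four-cycles with a chosen edge\<close>

definition chosen_four_cycle ::
  "nat \<Rightarrow> vertex \<Rightarrow> vertex \<Rightarrow> vertex \<Rightarrow> vertex \<Rightarrow> (vertex \<Rightarrow> vertex) set" where
  "chosen_four_cycle n x y z w =
     {c. (c x = y \<or> c y = x) \<and> present n c y z \<and> present n c z w \<and> present n c w x}"

text \<open>The factor \<open>2\<close> counts who made the choice on the edge between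
  \<open>x\<close> and \<open>y\<close>. That choice forms \<open>D\<close>, the other three edges
  form \<open>F\<close>, and distinctness of the vertices keeps them apart.\<close>

lemma prob_chosen_four_cycle_le:
  assumes n: "n \<ge> 2" and V: "{x, y, z, w} \<subseteq> torus_vertices n" and dist: "distinct [x, y, z, w]"
  shows "measure_pmf.prob (choices_pmf n) (chosen_four_cycle n x y z w)
    \<le> 2 / ln (real n) * (edge_weight n y z * edge_weight n z w * edge_weight n w x)"
proof -
  let ?P = "measure_pmf.prob (choices_pmf n)"
  let ?F = "{(y, z), (z, w), (w, x)}"
  let ?q = "edge_weight n y z * edge_weight n z w * edge_weight n w x"
  let ?X = "\<lambda>D. {c. (\<forall>(s, t)\<in>D. c s = t) \<and> (\<forall>(s, t)\<in>?F. present n c s t)}"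
  have bound: "?P (?X {(s, t)}) \<le> 1 / ln (real n) * ?q" if "(s, t) \<in> {(x, y), (y, x)}" for s t
  proof -
    have "?P (?X {(s, t)}) \<le> (\<Prod>(s, t)\<in>{(s, t)}. choice_prob n s t) * (\<Prod>(s, t)\<in>?F. edge_weight n s t)"
      using that V dist by (intro prob_present_le n) auto
    also have "\<dots> = choice_prob n s t * ?q"
      using dist by (simp add: mult.assoc)
    also have "\<dots> \<le> 1 / ln (real n) * ?q"
      using that V by (intro mult_right_mono choice_prob_le n mult_nonneg_nonneg edge_weight_nonneg) auto
    finally show ?thesis .
  qed
  have "?P (chosen_four_cycle n x y z w) \<le> ?P (?X {(x, y)} \<union> ?X {(y, x)})"
    by (rule measure_pmf.finite_measure_mono) (auto simp: chosen_four_cycle_def)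
  also have "\<dots> \<le> ?P (?X {(x, y)}) + ?P (?X {(y, x)})"
    by (rule measure_Un_le) auto
  also have "\<dots> \<le> 1 / ln (real n) * ?q + 1 / ln (real n) * ?q"
    by (intro add_mono bound) auto
  finally show ?thesis by (simp add: mult_ac)
qed

text \<open>Reversing the cycle, the long-range edge may be assumed to be the first or the second one.\<close>

lemma long_range_four_cycle_chosen:
  assumes "has_long_range_four_cycle n (utsw_edges n c) u"
  obtains x y z where "{u, x, y, z} \<subseteq> torus_vertices n" "distinct [u, x, y, z]"
    "c \<in> chosen_four_cycle n u x y z \<union> chosen_four_cycle n x y z u"
proof -
  obtain x y z where cyc: "rooted_four_cycle n (utsw_edges n c) u x y z"
    and ex: "\<exists>e \<in> {{u, x}, {x, y}, {y, z}, {z, u}}. e \<in> utsw_edges n c - torus_edges n"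
    using assms by (auto simp: has_long_range_four_cycle_def)
  have V: "{u, x, y, z} \<subseteq> torus_vertices n" "distinct [u, x, y, z]"
    and E: "present n c u x" "present n c x y" "present n c y z" "present n c z u"
    using cyc by (auto simp: rooted_four_cycle_def intro: utsw_edgesD)
  have E': "present n c x u" "present n c y x" "present n c z y" "present n c u z"
    using E by (simp_all add: present_commute)
  consider "c u = x \<or> c x = u" | "c x = y \<or> c y = x" | "c y = z \<or> c z = y" | "c z = u \<or> c u = z"
    using ex utsw_edgesD(2) by blast
  then show thesis
  proof cases
    case 1
    with V E that[of x y z] show thesis by (auto simp: chosen_four_cycle_def)
  next
    case 2
    with V E that[of x y z] show thesis by (auto simp: chosen_four_cycle_def)
  next
    case 3
    with V E' that[of z y x] show thesis by (auto simp: chosen_four_cycle_def)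
  next
    case 4
    with V E' that[of z y x] show thesis by (auto simp: chosen_four_cycle_def)
  qed
qed

section \<open>Sums over three-edge paths and the union bound\<close>

lemma sum_edge_weight_mult_le:
  assumes "n \<ge> 2" "u \<in> torus_vertices n" "K \<ge> 0" "\<And>x. x \<in> torus_vertices n \<Longrightarrow> g x \<le> K"
  shows "(\<Sum>x\<in>torus_vertices n. edge_weight n u x * g x) \<le> 6 * K"
proof -
  have "(\<Sum>x\<in>torus_vertices n. edge_weight n u x * g x)
      \<le> (\<Sum>x\<in>torus_vertices n. edge_weight n u x) * K"
    unfolding sum_distrib_right by (intro sum_mono mult_left_mono edge_weight_nonneg assms(4))
  also have "\<dots> \<le> 6 * K"
    using assms by (intro mult_right_mono sum_edge_weight) auto
  finally show ?thesis .
qed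

text \<open>The map \<open>f\<close> selects where the third edge is attached:
  \<open>f y = y\<close> gives paths starting at \<open>u\<close>, and \<open>f y = u\<close> gives
  paths with \<open>u\<close> as an inner vertex. Summing from the innermost vertex outwards costs
  \<open>6\<close> each time, and \<open>216 = 6 * 6 * 6\<close>.\<close>

lemma sum_three_edge_weights_le:
  assumes n: "n \<ge> 2" and u: "u \<in> torus_vertices n"
    and f: "\<And>y. y \<in> torus_vertices n \<Longrightarrow> f y \<in> torus_vertices n"
  shows "(\<Sum>(z, y, x)\<in>torus_vertices n \<times> torus_vertices n \<times> torus_vertices n.
           edge_weight n u z * edge_weight n z y * edge_weight n (f y) x) \<le> 216"
proof -
  let ?V = "torus_vertices n"
  have "(\<Sum>(z, y, x)\<in>?V \<times> ?V \<times> ?V. edge_weight n u z * edge_weight n z y * edge_weight n (f y) x)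
      = (\<Sum>z\<in>?V. edge_weight n u z * (\<Sum>y\<in>?V. edge_weight n z y * (\<Sum>x\<in>?V. edge_weight n (f y) x)))"
    by (simp add: sum.cartesian_product[symmetric] sum_distrib_left mult.assoc)
  also have "\<dots> \<le> 6 * (6 * 6)"
    by (intro sum_edge_weight_mult_le sum_edge_weight n u f) auto
  finally show ?thesis by simp
qed

lemma prob_long_range_four_cycle_le:
  assumes n: "n \<ge> 2" and u: "u \<in> torus_vertices n"
  shows "measure_pmf.prob (utsw_pmf n) {E. has_long_range_four_cycle n E u} \<le> 864 / ln (real n)"
proof -
  let ?V = "torus_vertices n" and ?P = "measure_pmf.prob (choices_pmf n)" and ?w = "edge_weight n"
  define T where "T = {(z, y, x). {u, x, y, z} \<subseteq> ?V \<and> distinct [u, x, y, z]}"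
  define X where "X = (\<lambda>(z, y, x). chosen_four_cycle n u x y z \<union> chosen_four_cycle n x y z u)"
  \<comment> \<open>The first summand is the path left when the edge between \<open>u\<close> and
    \<open>x\<close> is the chosen one, the second when it is the edge between \<open>x\<close> and
    \<open>y\<close>.\<close>
  define b where "b = (\<lambda>(z, y, x). 2 / ln (real n) *
      (?w u z * ?w z y * ?w y x + ?w u z * ?w z y * ?w u x))"
  have ln: "0 < ln (real n)"
    using n by simp
  have fin: "finite (?V \<times> ?V \<times> ?V)"
    by (simp add: finite_torus_vertices)
  have T: "T \<subseteq> ?V \<times> ?V \<times> ?V"
    by (auto simp: T_def)
  have Xb: "?P (X t) \<le> b t" if t: "t \<in> T" for t
  proof -
    obtain z y x where zyx: "t = (z, y, x)" by (cases t)
    have V: "{u, x, y, z} \<subseteq> ?V" "{x, y, z, u} \<subseteq> ?V"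
      and dist: "distinct [u, x, y, z]" "distinct [x, y, z, u]"
      using t by (auto simp: T_def zyx)
    have "?P (X t) \<le> ?P (chosen_four_cycle n u x y z) + ?P (chosen_four_cycle n x y z u)"
      unfolding X_def zyx prod.case by (rule measure_Un_le) auto
    also have "\<dots> \<le> 2 / ln (real n) * (?w x y * ?w y z * ?w z u)
        + 2 / ln (real n) * (?w y z * ?w z u * ?w u x)"
      by (intro add_mono prob_chosen_four_cycle_le n V dist)
    also have "\<dots> = b t"
      by (simp add: b_def zyx edge_weight_commute[of n x y] edge_weight_commute[of n y z]
          edge_weight_commute[of n z u] distrib_left mult_ac)
    finally show ?thesis .
  qed
  have "measure_pmf.prob (utsw_pmf n) {E. has_long_range_four_cycle n E u}
      = ?P {c. has_long_range_four_cycle n (utsw_edges n c) u}"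
    by (simp add: utsw_pmf_def vimage_def)
  also have "\<dots> \<le> ?P (\<Union>t\<in>T. X t)"
  proof (rule measure_pmf.finite_measure_mono)
    show "{c. has_long_range_four_cycle n (utsw_edges n c) u} \<subseteq> (\<Union>t\<in>T. X t)"
    proof
      fix c assume "c \<in> {c. has_long_range_four_cycle n (utsw_edges n c) u}"
      then have "has_long_range_four_cycle n (utsw_edges n c) u" by simp
      then obtain x y z where "{u, x, y, z} \<subseteq> ?V" "distinct [u, x, y, z]"
        "c \<in> chosen_four_cycle n u x y z \<union> chosen_four_cycle n x y z u"
        by (rule long_range_four_cycle_chosen)
      then have "(z, y, x) \<in> T" "c \<in> X (z, y, x)"
        by (simp_all add: T_def X_def)
      then show "c \<in> (\<Union>t\<in>T. X t)" by blast
    qed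
  qed auto
  also have "\<dots> \<le> (\<Sum>t\<in>T. ?P (X t))"
    using finite_subset[OF T fin] by (intro measure_pmf.finite_measure_subadditive_finite) auto
  also have "\<dots> \<le> (\<Sum>t\<in>T. b t)"
    by (intro sum_mono Xb)
  \<comment> \<open>Triples with repeated vertices only add nonnegative terms, and the sum over the
    full product factors vertex by vertex.\<close>
  also have "\<dots> \<le> (\<Sum>t\<in>?V \<times> ?V \<times> ?V. b t)"
    using T fin ln
    by (intro sum_mono2) (auto simp: b_def intro!: divide_nonneg_pos add_nonneg_nonneg mult_nonneg_nonneg edge_weight_nonneg)
  also have "\<dots> = 2 / ln (real n) *
      ((\<Sum>(z, y, x)\<in>?V \<times> ?V \<times> ?V. ?w u z * ?w z y * ?w y x)
       + (\<Sum>(z, y, x)\<in>?V \<times> ?V \<times> ?V. ?w u z * ?w z y * ?w u x))"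
    by (simp add: b_def case_prod_unfold sum_distrib_left sum.distrib distrib_left)
  \<comment> \<open>One path bound for each of the two positions of the chosen edge; this yields the
    constant \<open>864\<close>.\<close>
  also have "\<dots> \<le> 2 / ln (real n) * (216 + 216)"
    using ln u sum_three_edge_weights_le[OF n u, of "\<lambda>y. y"] sum_three_edge_weights_le[OF n u, of "\<lambda>y. u"]
    by (intro mult_left_mono add_mono) auto
  finally show ?thesis by simp
qed

theorem theorem21:
  "\<exists>C>0. \<forall>\<^sub>F n in sequentially. \<forall>u\<in>torus_vertices n.
     measure_pmf.prob (utsw_pmf n) {E. has_long_range_four_cycle n E u} \<le> C * (1 / ln (real n))"
proof (intro exI conjI)
  show "\<forall>\<^sub>F n in sequentially. \<forall>u\<in>torus_vertices n.
     measure_pmf.prob (utsw_pmf n) {E. has_long_range_four_cycle n E u} \<le> 864 * (1 / ln (real n))"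
    using eventually_ge_at_top[of 2] by eventually_elim (simp add: prob_long_range_four_cycle_le)
qed simp

end
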